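(* Let $\mathscr{H}$ be a finite dimensional complex Hilbert space with inner product $[\cdot,\cdot]$ and let $T, S\in\mathbb{B}(\mathscr{H})$. The following statements are equivalent: (i) $T\parallel S$. (ii) There exists a unit vector $\xi\in\mathscr{H}$ such that $|[T\xi, S\xi]| = \|T\|\,\|S\|$. (iii) There exists a unit vector $\xi\in\mathscr{H}$ such that $\|T\xi\| = \|T\|$, $\|S\xi\| = \|S\|$ and $T\xi\parallel S\xi$.
   Context: $\mathbb{B}(\mathscr{H})$ is the $C^*$-algebra of bounded operators on $\mathscr{H}$ with the operator norm. In a normed space (here $\mathbb{B}(\mathscr{H})$ or $\mathscr{H}$), $x\parallel y$ (norm-parallel) means that $\|x+\lambda y\|=\|x\|+\|y\|$ for some $\lambda\in\mathbb{T}=\{\alpha\in\mathbb{C}:|\alpha|=1\}$. *)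

theory Defs
  imports "HOL-Analysis.Analysis"
begin

class complex_vector = real_vector +
  fixes scaleC :: "complex \<Rightarrow> 'a \<Rightarrow> 'a" (infixr "*\<^sub>C" 75)
  assumes scaleC_add_right: "a *\<^sub>C (x + y) = a *\<^sub>C x + a *\<^sub>C y"
    and scaleC_add_left: "(a + b) *\<^sub>C x = a *\<^sub>C x + b *\<^sub>C x"
    and scaleC_scaleC: "a *\<^sub>C b *\<^sub>C x = (a * b) *\<^sub>C x"
    and scaleC_one: "1 *\<^sub>C x = x"
    and scaleR_scaleC: "r *\<^sub>R x = complex_of_real r *\<^sub>C x"

interpretation complex_vector: vector_space "scaleC :: complex \<Rightarrow> 'a \<Rightarrow> 'a::complex_vector"
  by unfold_locales
    (simp_all add: scaleC_add_right scaleC_add_left scaleC_scaleC scaleC_one)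

class complex_normed_vector = complex_vector + real_normed_vector +
  assumes norm_scaleC: "norm (a *\<^sub>C x) = cmod a * norm x"

text \<open>The inner product is linear in the first argument.\<close>

class complex_inner = complex_normed_vector +
  fixes cinner :: "'a \<Rightarrow> 'a \<Rightarrow> complex"
  assumes cinner_commute: "cinner x y = cnj (cinner y x)"
    and cinner_add_left: "cinner (x + y) z = cinner x z + cinner y z"
    and cinner_scaleC_left: "cinner (a *\<^sub>C x) y = a * cinner x y"
    and cinner_self_nonneg: "0 \<le> Re (cinner x x)"
    and cinner_self_eq_zero_iff: "cinner x x = 0 \<longleftrightarrow> x = 0"
    and norm_eq_sqrt_cinner: "norm x = sqrt (Re (cinner x x))"

class chilbert_space = complex_inner + complete_space

lemma bounded_linear_scaleC: "bounded_linear (\<lambda>x::'a::complex_normed_vector. a *\<^sub>C x)"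
  by (rule bounded_linear_intro[where K = "cmod a"])
    (simp_all add: scaleC_add_right scaleR_scaleC scaleC_scaleC norm_scaleC mult.commute)

text \<open>
  The library type of bounded operators consists of the real-linear ones. With the pointwise
  complex scaling it is a complex normed space under the operator norm, and the complex-linear
  operators, collected in \<open>bounded_operators\<close> below, form a complex subspace of it.
\<close>

instantiation blinfun :: (real_normed_vector, complex_normed_vector) complex_normed_vector
begin

lift_definition scaleC_blinfun :: "complex \<Rightarrow> ('a \<Rightarrow>\<^sub>L 'b) \<Rightarrow> ('a \<Rightarrow>\<^sub>L 'b)"
  is "\<lambda>a f x. a *\<^sub>C f x"
  by (rule bounded_linear_compose[OF bounded_linear_scaleC])

instance
proof
  fix a b :: complex and r :: real and f g :: "'a \<Rightarrow>\<^sub>L 'b"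
  show "a *\<^sub>C (f + g) = a *\<^sub>C f + a *\<^sub>C g"
    by transfer (simp add: scaleC_add_right)
  show "(a + b) *\<^sub>C f = a *\<^sub>C f + b *\<^sub>C f"
    by transfer (simp add: scaleC_add_left)
  show "a *\<^sub>C b *\<^sub>C f = (a * b) *\<^sub>C f"
    by transfer (simp add: scaleC_scaleC)
  show "1 *\<^sub>C f = f"
    by transfer (simp add: scaleC_one)
  show "r *\<^sub>R f = complex_of_real r *\<^sub>C f"
    by transfer (simp add: scaleR_scaleC)
  show "norm (a *\<^sub>C f) = cmod a * norm f"
  proof transfer
    fix a :: complex and f :: "'a \<Rightarrow> 'b"
    assume f: "bounded_linear f"
    have "onorm (\<lambda>x. a *\<^sub>C f x) = onorm (\<lambda>x. cmod a *\<^sub>R f x)"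
      by (simp add: onorm_def norm_scaleC)
    also have "\<dots> = cmod a * onorm f"
      using onorm_scaleR[OF f, of "cmod a"] by simp
    finally show "onorm (\<lambda>x. a *\<^sub>C f x) = cmod a * onorm f" .
  qed
qed

end

definition bounded_operators :: "('a::complex_normed_vector \<Rightarrow>\<^sub>L 'a) set" where
  "bounded_operators = {T. Vector_Spaces.linear scaleC scaleC (blinfun_apply T)}"

definition norm_parallel :: "'a::complex_normed_vector \<Rightarrow> 'a \<Rightarrow> bool" where
  "norm_parallel x y \<longleftrightarrow> (\<exists>l. cmod l = 1 \<and> norm (x + l *\<^sub>C y) = norm x + norm y)"

end

theory Submission
  imports Defs
begin

text \<open>
  For unit scalars \<open>l\<close>, the polarization identity
  \<open>\<parallel>x + l y\<parallel>\<^sup>2 = \<parallel>x\<parallel>\<^sup>2 + \<parallel>y\<parallel>\<^sup>2 + 2 Re (cnj l [x, y])\<close> shows that the triangle inequality for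
  \<open>x\<close> and \<open>l y\<close> is an equality exactly when \<open>Re (cnj l [x, y]) = \<parallel>x\<parallel> \<parallel>y\<parallel>\<close>. A suitable phase \<open>l\<close>
  turns \<open>cnj l [x, y]\<close> into \<open>\<bar>[x, y]\<bar>\<close>, so two vectors are norm-parallel if and only if they give
  equality in the Cauchy--Schwarz inequality (\<open>norm_parallel_iff_cinner\<close>).

  The operators are reduced to vectors by norm attainment: the closed unit ball of a
  finite-dimensional space is compact (\<open>compact_span_Int_cball\<close>), so every bounded operator
  attains its norm at a unit vector (\<open>blinfun_attains_norm\<close>). If \<open>\<parallel>T + l S\<parallel> = \<parallel>T\<parallel> + \<parallel>S\<parallel>\<close>,
  then at a vector \<open>\<xi>\<close> where \<open>T + l S\<close> attains its norm both inequalities in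
  \<open>\<parallel>T \<xi> + l S \<xi>\<parallel> \<le> \<parallel>T \<xi>\<parallel> + \<parallel>S \<xi>\<parallel> \<le> \<parallel>T\<parallel> + \<parallel>S\<parallel>\<close> are equalities: \<open>T\<close> and \<open>S\<close> both attain their
  norms at \<open>\<xi>\<close>, with norm-parallel values, and the converse is the same chain read backwards.
  Equality in \<open>\<bar>[T \<xi>, S \<xi>]\<bar> \<le> \<parallel>T \<xi>\<parallel> \<parallel>S \<xi>\<parallel> \<le> \<parallel>T\<parallel> \<parallel>S\<parallel>\<close> says the same thing about \<open>\<xi>\<close> unless
  one of the operators vanishes; in that case \<open>\<xi>\<close> is replaced by a vector at which the other
  operator attains its norm.
\<close>

lemma norm_add_phase_squared:
  fixes x y :: "'a::complex_inner"
  assumes "cmod l = 1"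
  shows "(norm (x + l *\<^sub>C y))\<^sup>2 = (norm x)\<^sup>2 + (norm y)\<^sup>2 + 2 * Re (cnj l * cinner x y)"
proof -
  have norm_sq: "(norm z)\<^sup>2 = Re (cinner z z)" for z :: 'a
    by (simp add: norm_eq_sqrt_cinner cinner_self_nonneg)
  have add_right: "cinner u (v + w) = cinner u v + cinner u w" for u v w :: 'a
    by (metis cinner_commute cinner_add_left complex_cnj_add)
  have scale_right: "cinner u (l *\<^sub>C v) = cnj l * cinner u v" for u v :: 'a
    by (metis cinner_commute cinner_scaleC_left complex_cnj_mult)
  have cross: "Re (l * cinner y x) = Re (cnj l * cinner x y)"
    by (subst cinner_commute) simp
  have "(norm (l *\<^sub>C y))\<^sup>2 = (norm y)\<^sup>2"
    by (simp add: norm_scaleC assms)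
  then show ?thesis
    using cross
    by (simp add: norm_sq cinner_add_left add_right)
       (simp add: scale_right cinner_scaleC_left)
qed

lemma exists_aligning_phase: "\<exists>l. cmod l = 1 \<and> cnj l * z = complex_of_real (cmod z)"
proof (cases "z = 0")
  case True
  then show ?thesis by (auto intro: exI[of _ 1])
next
  case False
  then have "cnj (sgn z) * z = complex_of_real (cmod z)"
    by (simp add: sgn_eq field_simps complex_norm_square power2_eq_square flip: of_real_mult)
       (metis complex_norm_square power2_eq_square mult.commute)
  then show ?thesis
    using False by (intro exI[of _ "sgn z"]) (simp add: norm_sgn)
qed

text \<open>
  The norm is already known to satisfy the triangle inequality, so Cauchy--Schwarz is read off
  from it by squaring, after aligning the phases of the two vectors.
\<close>

lemma cmod_cinner_le:
  fixes x y :: "'a::complex_inner"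
  shows "cmod (cinner x y) \<le> norm x * norm y"
proof -
  obtain l where l: "cmod l = 1" "cnj l * cinner x y = complex_of_real (cmod (cinner x y))"
    using exists_aligning_phase by blast
  have "norm (x + l *\<^sub>C y) \<le> norm x + norm y"
    using norm_triangle_ineq[of x "l *\<^sub>C y"] l(1) by (simp add: norm_scaleC)
  then have "(norm (x + l *\<^sub>C y))\<^sup>2 \<le> (norm x + norm y)\<^sup>2"
    by (simp add: power_mono)
  then show ?thesis
    using norm_add_phase_squared[OF l(1), of x y] l(2) by (simp add: power2_sum)
qed

text \<open>
  Squaring the norm equality for a phase \<open>l\<close> leaves \<open>Re (cnj l [x, y]) = \<parallel>x\<parallel> \<parallel>y\<parallel>\<close>. As the left
  side is at most \<open>\<bar>[x, y]\<bar>\<close>, this forces equality in Cauchy--Schwarz; conversely, given that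
  equality, the aligning phase is a witness.
\<close>

lemma norm_parallel_iff_cinner:
  fixes x y :: "'a::complex_inner"
  shows "norm_parallel x y \<longleftrightarrow> cmod (cinner x y) = norm x * norm y"
proof
  assume "norm_parallel x y"
  then obtain l where l: "cmod l = 1" "norm (x + l *\<^sub>C y) = norm x + norm y"
    unfolding norm_parallel_def by blast
  have "Re (cnj l * cinner x y) = norm x * norm y"
    using norm_add_phase_squared[OF l(1), of x y] unfolding l(2) by (simp add: power2_sum)
  moreover have "Re (cnj l * cinner x y) \<le> cmod (cinner x y)"
    using complex_Re_le_cmod[of "cnj l * cinner x y"] l(1) by (simp add: norm_mult)
  ultimately show "cmod (cinner x y) = norm x * norm y"
    using cmod_cinner_le[of x y] by linarith
next
  assume eq: "cmod (cinner x y) = norm x * norm y"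
  obtain l where l: "cmod l = 1" "cnj l * cinner x y = complex_of_real (cmod (cinner x y))"
    using exists_aligning_phase by blast
  have "(norm (x + l *\<^sub>C y))\<^sup>2 = (norm x + norm y)\<^sup>2"
    using norm_add_phase_squared[OF l(1), of x y] l(2) eq by (simp add: power2_sum)
  then have "norm (x + l *\<^sub>C y) = norm x + norm y"
    by (simp add: power2_eq_iff_nonneg)
  then show "norm_parallel x y"
    unfolding norm_parallel_def using l(1) by blast
qed

text \<open>
  Induction on the spanning set. A new vector \<open>b\<close> outside \<open>span B\<close> keeps a positive distance \<open>d\<close>
  from it, since near \<open>b\<close> the subspace agrees with one of its compact, hence closed, bounded parts.
  Consequently
  \<open>\<parallel>c b + y\<parallel> \<ge> d \<bar>c\<bar>\<close> for \<open>y\<close> in \<open>span B\<close>, so on a ball both the coefficient \<open>c\<close> and the component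
  \<open>y\<close> stay in compact sets.
\<close>

lemma compact_span_Int_cball:
  fixes B :: "'a::complex_normed_vector set"
  assumes "finite B"
  shows "compact (complex_vector.span B \<inter> cball 0 r)"
  using assms
proof (induction B arbitrary: r rule: finite_induct)
  case empty
  have "finite ({0::'a} \<inter> cball 0 r)" by simp
  then show ?case
    by (simp add: finite_imp_compact)
next
  case (insert b B)
  let ?V = "complex_vector.span B"
  show ?case
  proof (cases "b \<in> ?V")
    case True
    then show ?thesis
      using insert.IH[of r] by (simp add: complex_vector.span_redundant)
  next
    case False
    have "open (- (?V \<inter> cball 0 (norm b + 1)))"
      by (intro open_Compl compact_imp_closed insert.IH)
    moreover have "b \<in> - (?V \<inter> cball 0 (norm b + 1))"
      using False by simp
    ultimately obtain e where "e > 0" "ball b e \<subseteq> - (?V \<inter> cball 0 (norm b + 1))"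
      by (rule openE)
    then have e: "e > 0" "\<And>y. y \<in> ?V \<inter> cball 0 (norm b + 1) \<Longrightarrow> e \<le> dist b y"
      by (auto simp: subset_iff not_less[symmetric])
    define d where "d = min e 1"
    have d: "d > 0" using e(1) by (simp add: d_def)
    have dist_b: "d \<le> norm (b - y)" if "y \<in> ?V" for y
    proof (cases "norm y \<le> norm b + 1")
      case True
      then show ?thesis
        using e(2)[of y] that by (simp add: d_def dist_norm)
    next
      case False
      then show ?thesis
        using norm_triangle_ineq2[of y b] by (simp add: d_def norm_minus_commute)
    qed
    have coeff_bound: "d * cmod c \<le> norm (c *\<^sub>C b + y)" if "y \<in> ?V" for c y
    proof (cases "c = 0")
      case True
      then show ?thesis by simp
    next
      case False
      have "c *\<^sub>C b + y = c *\<^sub>C (b - (- inverse c) *\<^sub>C y)"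
        using False by (simp add: scaleC_add_right scaleC_scaleC scaleC_one)
      then have "norm (c *\<^sub>C b + y) = cmod c * norm (b - (- inverse c) *\<^sub>C y)"
        by (simp add: norm_scaleC)
      moreover have "d \<le> norm (b - (- inverse c) *\<^sub>C y)"
        by (intro dist_b complex_vector.span_scale that)
      ultimately show ?thesis
        by (metis mult.commute mult_left_mono norm_ge_zero)
    qed
    define K where "K = cball (0::complex) (r / d) \<times> (?V \<inter> cball 0 (r + r / d * norm b))"
    define f where "f = (\<lambda>p. fst p *\<^sub>C b + snd p)"
    have lin: "bounded_linear (\<lambda>c. c *\<^sub>C b)"
      by (rule bounded_linear_intro[where K = "norm b"])
        (simp_all add: scaleC_add_left norm_scaleC scaleR_scaleC scaleC_scaleC scaleR_conv_of_real)
    have "compact K"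
      unfolding K_def by (intro compact_Times compact_cball insert.IH)
    moreover have "continuous_on K f"
      unfolding f_def
      by (intro continuous_on_add bounded_linear.continuous_on[OF lin] continuous_intros)
    ultimately have "compact (f ` K)"
      by (metis compact_continuous_image)
    then have "compact (f ` K \<inter> cball 0 r)"
      by (rule compact_Int_closed) simp
    moreover have "complex_vector.span (insert b B) \<inter> cball 0 r = f ` K \<inter> cball 0 r"
    proof (intro equalityI subsetI)
      fix x assume x: "x \<in> complex_vector.span (insert b B) \<inter> cball 0 r"
      then obtain c where c: "x - c *\<^sub>C b \<in> ?V"
        by (auto simp: complex_vector.span_insert)
      have "d * cmod c \<le> r"
        using coeff_bound[OF c, of c] x by simp
      then have c_le: "cmod c \<le> r / d"
        using d by (simp add: field_simps)
      have "norm (x - c *\<^sub>C b) \<le> norm x + cmod c * norm b"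
        using norm_triangle_ineq4[of x "c *\<^sub>C b"] by (simp add: norm_scaleC)
      also have "\<dots> \<le> r + r / d * norm b"
        using x c_le by (intro add_mono mult_right_mono) auto
      finally have "(c, x - c *\<^sub>C b) \<in> K"
        using c c_le by (simp add: K_def)
      moreover have "x = f (c, x - c *\<^sub>C b)"
        by (simp add: f_def)
      ultimately show "x \<in> f ` K \<inter> cball 0 r"
        using x by blast
    next
      fix x assume x: "x \<in> f ` K \<inter> cball 0 r"
      then obtain p where p: "p \<in> K" "x = f p" by blast
      then have "x - fst p *\<^sub>C b \<in> ?V"
        by (auto simp: f_def K_def)
      then show "x \<in> complex_vector.span (insert b B) \<inter> cball 0 r"
        using x by (auto simp: complex_vector.span_insert)
    qed
    ultimately show ?thesis by simp
  qed
qed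

lemma blinfun_attains_norm:
  fixes A :: "'a::complex_normed_vector \<Rightarrow>\<^sub>L 'b::real_normed_vector"
  assumes "finite B" and "complex_vector.span B = (UNIV :: 'a set)" and "\<exists>x::'a. x \<noteq> 0"
  obtains \<xi> where "norm \<xi> = 1" and "norm (A \<xi>) = norm A"
proof -
  have "compact (cball (0::'a) 1)"
    using compact_span_Int_cball[OF assms(1), of 1] assms(2) by simp
  then have "compact (cball (0::'a) 1 - ball 0 1)"
    by (rule compact_diff) simp
  moreover have "cball (0::'a) 1 - ball 0 1 = sphere 0 1"
    by auto
  ultimately have comp: "compact (sphere (0::'a) 1)"
    by simp
  obtain x :: 'a where "x \<noteq> 0"
    using assms(3) by blast
  then have "sgn x \<in> sphere 0 1"
    by (simp add: norm_sgn)
  then have "sphere (0::'a) 1 \<noteq> {}" by blast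
  moreover have "continuous_on (sphere 0 1) (\<lambda>x. norm (A x))"
    by (intro continuous_intros)
  ultimately obtain \<xi> where \<xi>: "norm \<xi> = 1" "\<And>x. norm x = 1 \<Longrightarrow> norm (A x) \<le> norm (A \<xi>)"
    using continuous_attains_sup[OF comp] by (metis mem_sphere_0)
  have "norm A \<le> norm (A \<xi>)"
  proof (rule norm_blinfun_bound)
    fix x :: 'a
    show "norm (A x) \<le> norm (A \<xi>) * norm x"
    proof (cases "x = 0")
      case True
      then show ?thesis by (simp add: blinfun.zero_right)
    next
      case False
      then have "norm (A (sgn x)) \<le> norm (A \<xi>)"
        by (intro \<xi>(2)) (simp add: norm_sgn)
      then show ?thesis
        using False by (simp add: sgn_div_norm blinfun.scaleR_right field_simps)
    qed
  qed simp
  moreover have "norm (A \<xi>) \<le> norm A"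
    using norm_blinfun[of A \<xi>] \<xi>(1) by simp
  ultimately show thesis
    using that \<xi>(1) by force
qed

theorem theorem2p13:
  fixes T S :: "'a::chilbert_space \<Rightarrow>\<^sub>L 'a"
  assumes finite_dim: "\<exists>B::'a set. finite B \<and> complex_vector.span B = UNIV"
    and nonzero: "\<exists>x::'a. x \<noteq> 0"
    and T: "T \<in> bounded_operators"
    and S: "S \<in> bounded_operators"
  shows "(norm_parallel T S \<longleftrightarrow>
            (\<exists>\<xi>::'a. norm \<xi> = 1 \<and> cmod (cinner (T \<xi>) (S \<xi>)) = norm T * norm S)) \<and>
         ((\<exists>\<xi>::'a. norm \<xi> = 1 \<and> cmod (cinner (T \<xi>) (S \<xi>)) = norm T * norm S) \<longleftrightarrow>
            (\<exists>\<xi>::'a. norm \<xi> = 1 \<and> norm (T \<xi>) = norm T \<and> norm (S \<xi>) = norm S \<and>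
                     norm_parallel (T \<xi>) (S \<xi>)))"
    (is "(?i \<longleftrightarrow> ?ii) \<and> (?ii \<longleftrightarrow> ?iii)")
proof -
  obtain B :: "'a set" where B: "finite B" "complex_vector.span B = UNIV"
    using finite_dim by blast
  note attains = blinfun_attains_norm[OF B nonzero]
  have apply_sum: "(T + l *\<^sub>C S) \<xi> = T \<xi> + l *\<^sub>C S \<xi>" for l \<xi>
    by (simp add: blinfun.add_left scaleC_blinfun.rep_eq)
  have le: "norm (T \<xi>) \<le> norm T" "norm (S \<xi>) \<le> norm S" if "norm \<xi> = 1" for \<xi>
    using norm_blinfun[of T \<xi>] norm_blinfun[of S \<xi>] that by simp_all
  have i_iii: ?iii if ?i
  proof -
    from that obtain l where l: "cmod l = 1" "norm (T + l *\<^sub>C S) = norm T + norm S"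
      unfolding norm_parallel_def by blast
    obtain \<xi> where \<xi>: "norm \<xi> = 1" "norm ((T + l *\<^sub>C S) \<xi>) = norm (T + l *\<^sub>C S)"
      by (rule attains)
    have sum: "norm (T \<xi> + l *\<^sub>C S \<xi>) = norm T + norm S"
      using \<xi>(2) l(2) by (simp only: apply_sum)
    have "norm (T \<xi> + l *\<^sub>C S \<xi>) \<le> norm (T \<xi>) + norm (S \<xi>)"
      using norm_triangle_ineq[of "T \<xi>" "l *\<^sub>C S \<xi>"] l(1) by (simp add: norm_scaleC)
    then have "norm (T \<xi>) = norm T" "norm (S \<xi>) = norm S"
      using sum le[OF \<xi>(1)] by linarith+
    then show ?iii
      using \<xi>(1) l(1) sum unfolding norm_parallel_def by metis
  qed
  have iii_i: ?i if ?iii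
  proof -
    from that obtain \<xi> l where \<xi>: "norm \<xi> = 1" "cmod l = 1"
        "norm (T \<xi> + l *\<^sub>C S \<xi>) = norm T + norm S"
      unfolding norm_parallel_def by metis
    have "norm T + norm S \<le> norm (T + l *\<^sub>C S)"
      using norm_blinfun[of "T + l *\<^sub>C S" \<xi>] \<xi> by (simp add: apply_sum)
    moreover have "norm (T + l *\<^sub>C S) \<le> norm T + norm S"
      using norm_triangle_ineq[of T "l *\<^sub>C S"] \<xi>(2) by (simp add: norm_scaleC)
    ultimately show ?i
      unfolding norm_parallel_def using \<xi>(2) by force
  qed
  have iii_ii: ?ii if ?iii
    using that unfolding norm_parallel_iff_cinner by metis
  have ii_iii: ?iii if ?ii
  proof -
    from that obtain \<xi> where \<xi>: "norm \<xi> = 1" "cmod (cinner (T \<xi>) (S \<xi>)) = norm T * norm S"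
      by blast
    consider "T = 0" | "S = 0" | "T \<noteq> 0" "S \<noteq> 0" by blast
    then show ?iii
    proof cases
      case 1
      obtain \<eta> where "norm \<eta> = 1" "norm (S \<eta>) = norm S"
        by (rule attains)
      with 1 show ?thesis
        by (intro exI[of _ \<eta>]) (auto simp: norm_parallel_def norm_scaleC intro: exI[of _ 1])
    next
      case 2
      obtain \<eta> where "norm \<eta> = 1" "norm (T \<eta>) = norm T"
        by (rule attains)
      with 2 show ?thesis
        by (intro exI[of _ \<eta>]) (auto simp: norm_parallel_def intro: exI[of _ 1])
    next
      case 3
      have prod: "norm T * norm S \<le> norm (T \<xi>) * norm (S \<xi>)"
        using cmod_cinner_le[of "T \<xi>" "S \<xi>"] \<xi>(2) by simp
      \<comment> \<open>A positive product of upper bounds is reached only if both bounds are.\<close>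
      have "norm T * norm S \<le> norm (T \<xi>) * norm S"
        using prod le[OF \<xi>(1)] by (meson mult_left_mono norm_ge_zero order_trans)
      then have "norm (T \<xi>) = norm T"
        using le(1)[OF \<xi>(1)] 3 by simp
      moreover have "norm T * norm S \<le> norm T * norm (S \<xi>)"
        using prod le[OF \<xi>(1)] by (meson mult_right_mono norm_ge_zero order_trans)
      then have "norm (S \<xi>) = norm S"
        using le(2)[OF \<xi>(1)] 3 by simp
      ultimately show ?thesis
        using \<xi> unfolding norm_parallel_iff_cinner by metis
    qed
  qed
  show ?thesis
    using i_iii iii_i iii_ii ii_iii by blast
qed

end
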